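(* Let $N\ge 2$, let $\mathcal{X}_2$ be a real Banach space and let $\mathcal{X}=\mathbb{R}^N\times\mathcal{X}_2$. Consider the set $G=I\times\overline{\mathbb{B}}(R)\times\Xi\subset\mathcal{X}$, where $I\subset\mathbb{R}$ is a closed (bounded) interval, $\overline{\mathbb{B}}(R)\subset\mathbb{R}^{N-1}$ is the closed ball of radius $R>0$ centred at $0$, and $\Xi$ is a closed, convex and bounded subset of $\mathcal{X}_2$. Let $F:G\to \operatorname{int} I\times\mathbb{B}(R)\times\Xi$ be a continuous and compact map with a periodic point $o_0=(p_0,q_0,r_0)$ of least period $n$, and denote its orbit by $o_i=(p_i,q_i,r_i):=F^i(p_0,q_0,r_0)$, $i=0,\dots,n-1$ (indices are taken modulo $n$). Suppose that there exist $\delta_0,\delta_1,\dots,\delta_{n-1}>0$ such that the intervals $[p_i-\delta_i,p_i+\delta_i]\subset I$, $i=0,\dots,n-1$, are pairwise disjoint and, for all $i\in\{0,\dots,n-1\}$, $$F\big([p_i-\delta_i,p_i+\delta_i]\times\overline{\mathbb{B}}(R)\times\Xi\big)\subset(p_{i+1}-\delta_{i+1},p_{i+1}+\delta_{i+1})\times\mathbb{B}(R)\times\Xi .$$ Then for every natural number $m$ succeeding $n$ in the Sharkovskii order (that is, $n\triangleleft m$), $F$ has a periodic point with least period $m$.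
   Context: $\mathbb{B}(R)$ and $\overline{\mathbb{B}}(R)$ denote the open and closed balls of radius $R$ centred at $0$ in $\mathbb{R}^{N-1}$ with the maximum norm. A map $F:\operatorname{dom}(F)\subset\mathcal{X}\to\mathcal{X}$ is compact if for every bounded $Y\subset\operatorname{dom}(F)$ the closure of $F(Y)$ is compact in $\mathcal{X}$. The Sharkovskii order $\triangleleft$ on the positive integers is $$3\triangleleft5\triangleleft7\triangleleft9\triangleleft\cdots\triangleleft2\cdot3\triangleleft2\cdot5\triangleleft2\cdot7\triangleleft\cdots\triangleleft2^2\cdot3\triangleleft2^2\cdot5\triangleleft2^2\cdot7\triangleleft\cdots\triangleleft2^3\cdot3\triangleleft2^3\cdot5\triangleleft\cdots\triangleleft2^{k+1}\triangleleft2^k\triangleleft2^{k-1}\triangleleft\cdots\triangleleft2^2\triangleleft2\triangleleft1 .$$ *)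

theory Defs
  imports "HOL-Analysis.Analysis"
begin

(* Strict order; the four rules are the four kinds of comparison in the usual display:
   same row, different rows, any row against the final tail of powers of two,
   and within that tail (which is decreasing). *)
inductive sharkovskii :: "nat \<Rightarrow> nat \<Rightarrow> bool"  (infix "\<lhd>\<^sub>S" 50) where
  same_row: "odd r \<Longrightarrow> odd s \<Longrightarrow> 1 < r \<Longrightarrow> r < s \<Longrightarrow> 2 ^ k * r \<lhd>\<^sub>S 2 ^ k * s"
| later_row: "odd r \<Longrightarrow> odd s \<Longrightarrow> 1 < r \<Longrightarrow> 1 < s \<Longrightarrow> k < l \<Longrightarrow> 2 ^ k * r \<lhd>\<^sub>S 2 ^ l * s"
| row_tail: "odd r \<Longrightarrow> 1 < r \<Longrightarrow> 2 ^ k * r \<lhd>\<^sub>S 2 ^ l"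
| tail: "l < k \<Longrightarrow> 2 ^ k \<lhd>\<^sub>S 2 ^ l"

(* On real ^ 'k the library's infnorm is the maximum norm, see infnorm_cart. *)
definition max_ball :: "real \<Rightarrow> (real ^ 'k) set" where
  "max_ball R = {x. infnorm x < R}"

definition max_cball :: "real \<Rightarrow> (real ^ 'k) set" where
  "max_cball R = {x. infnorm x \<le> R}"

(* Maps with domain D are total functions whose values outside D are irrelevant. *)
definition compact_map_on :: "'a::metric_space set \<Rightarrow> ('a \<Rightarrow> 'a) \<Rightarrow> bool" where
  "compact_map_on D f \<longleftrightarrow> (\<forall>Y. Y \<subseteq> D \<and> bounded Y \<longrightarrow> compact (closure (f ` Y)))"

definition periodic_point_on :: "'a set \<Rightarrow> ('a \<Rightarrow> 'a) \<Rightarrow> nat \<Rightarrow> 'a \<Rightarrow> bool" where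
  "periodic_point_on D f n x \<longleftrightarrow>
     0 < n \<and> (\<forall>k<n. (f ^^ k) x \<in> D) \<and> (f ^^ n) x = x \<and>
     (\<forall>k. 0 < k \<and> k < n \<longrightarrow> (f ^^ k) x \<noteq> x)"

end

theory Submission
  imports Defs
begin

text \<open>
  Since the neighbourhoods of the orbit points are mapped into each other, for orbit points
  \<open>u < v\<close> the slab over \<open>[u + \<delta>\<^sub>u, v - \<delta>\<^sub>v]\<close> is stretched by \<open>F\<close> across every slab over
  \<open>[s + \<delta>\<^sub>s, t - \<delta>\<^sub>t]\<close> for which \<open>s\<close> and \<open>t\<close> lie between the images of \<open>u\<close> and \<open>v\<close>.

  A closed chain of \<open>m\<close> such coverings contains an orbit with \<open>F\<^sup>m x = x\<close>. This is a fixed point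
  problem on an \<open>m\<close>-fold product for Schauder's theorem: the contracting coordinates are pushed
  forward by \<open>F\<close>, and each expanding coordinate is moved against the defect
  \<open>F\<^sub>1 (x\<^sub>i) - t\<^sub>i\<^sub>+\<^sub>1\<close> and clamped to its interval. The stretching prevents the clamping from
  being active at a fixed point. If the first interval of the chain is disjoint from all the
  others, \<open>m\<close> is the least period.

  Chains of all required lengths come from the permutation of the orbit, following the proof of
  Sharkovskii's theorem by Burns and Hasselblatt. Let \<open>p < q\<close> be adjacent orbit points around which
  the permutation \<open>\<sigma>\<close> switches sides. If every point switches sides, \<open>\<sigma>\<^sup>2\<close> cyclically permutes
  the left half, and its chains lift with doubled length. Otherwise a shortest path spiralling out
  from the centre to a point that stays on its side gives chains of every even length and of every
  length greater than that of the orbit.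
\<close>

section \<open>The fixed point theorems of Brouwer and Schauder\<close>

lemma tendsto_fun_iff:
  fixes f :: "'i \<Rightarrow> 'a \<Rightarrow> 'b::topological_space"
  shows "(f \<longlongrightarrow> l) F \<longleftrightarrow> (\<forall>a. ((\<lambda>i. f i a) \<longlongrightarrow> l a) F)"
  using limitin_componentwise[of "\<lambda>_. euclidean" UNIV f l F]
  by (simp add: euclidean_product_topology limitin_canonical_iff)

text \<open>Kuhn's combinatorial lemma on ever finer grids, followed by a compactness argument. The
  dimension \<open>n\<close> is a term; pinning the coordinates from \<open>n\<close> on to
  \<open>0\<close> makes the cube compact in the product topology.\<close>

lemma brouwer_cube_nat:
  fixes g :: "(nat \<Rightarrow> real) \<Rightarrow> nat \<Rightarrow> real" and n :: nat
  defines "S \<equiv> {x. (\<forall>i<n. 0 \<le> x i \<and> x i \<le> 1) \<and> (\<forall>i\<ge>n. x i = 0)}"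
  assumes cont: "\<And>i. i < n \<Longrightarrow> continuous_on S (\<lambda>x. g x i)"
    and maps: "\<And>x i. x \<in> S \<Longrightarrow> i < n \<Longrightarrow> 0 \<le> g x i \<and> g x i \<le> 1"
  shows "\<exists>x\<in>S. \<forall>i<n. g x i = x i"
proof -
  have "S = (\<Pi>\<^sub>E i\<in>UNIV. if i < n then {0..1} else {0})"
    by (force simp: S_def PiE_UNIV_domain split: if_splits)
  then have "compactin (product_topology (\<lambda>i. euclidean) UNIV) S"
    by (auto simp: compactin_PiE)
  then have "compact S"
    by (simp add: euclidean_product_topology)
  then have "seq_compact S"
    by (rule compact_imp_seq_compact)
  \<comment> \<open>On the cube, label \<open>0\<close> means that \<open>g\<close> does not
    decrease the coordinate, label \<open>1\<close> that \<open>g\<close> does not increase it. The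
    special cases at \<open>0\<close> and \<open>1\<close> are the boundary conditions of Kuhn's
    lemma.\<close>
  define lab where "lab x i = (if x i = 0 \<or> x i < 1 \<and> x i \<le> g x i then 0 else 1::nat)" for x i
  define sc where "sc p x i = (if i < n then real (x i) / real p else 0)" for p and x :: "nat \<Rightarrow> nat" and i
  have scS: "sc p x \<in> S" if "0 < p" "\<forall>i<n. x i \<le> p" for p x
    using that by (auto simp: S_def sc_def)
  have "\<forall>p. \<exists>q. (\<forall>i<n. q i < Suc p) \<and> (\<forall>i<n. \<exists>r s. (\<forall>j<n. q j \<le> r j \<and> r j \<le> q j + 1) \<and>
          (\<forall>j<n. q j \<le> s j \<and> s j \<le> q j + 1) \<and> lab (sc (Suc p) r) i \<noteq> lab (sc (Suc p) s) i)"
    (is "\<forall>p. ?Q p")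
  proof
    fix p
    define L where "L x = lab (sc (Suc p) x)" for x
    have *: "\<forall>x. (\<forall>i<n. x i \<le> Suc p) \<longrightarrow> (\<forall>i<n. L x i = 0 \<or> L x i = 1)"
      "\<forall>x. (\<forall>i<n. x i \<le> Suc p) \<longrightarrow> (\<forall>i<n. x i = 0 \<longrightarrow> L x i = 0)"
      "\<forall>x. (\<forall>i<n. x i \<le> Suc p) \<longrightarrow> (\<forall>i<n. x i = Suc p \<longrightarrow> L x i = 1)"
      by (simp_all add: L_def lab_def sc_def)
    obtain q where "\<forall>i<n. q i < Suc p" and "\<forall>i<n. \<exists>r s. (\<forall>j<n. q j \<le> r j \<and> r j \<le> q j + 1) \<and>
          (\<forall>j<n. q j \<le> s j \<and> s j \<le> q j + 1) \<and> L r i \<noteq> L s i"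
      by (rule kuhn_lemma[OF zero_less_Suc *])
    then show "?Q p"
      unfolding L_def by (intro exI[of _ q] conjI)
  qed
  from choice[OF this] obtain q where q: "\<And>p i. i < n \<Longrightarrow> q p i < Suc p"
    and rs: "\<And>p i. i < n \<Longrightarrow> \<exists>r s. (\<forall>j<n. q p j \<le> r j \<and> r j \<le> q p j + 1) \<and>
          (\<forall>j<n. q p j \<le> s j \<and> s j \<le> q p j + 1) \<and> lab (sc (Suc p) r) i \<noteq> lab (sc (Suc p) s) i"
    by blast
  define z where "z p = sc (Suc p) (q p)" for p
  have "\<forall>p. z p \<in> S"
    using q by (auto simp: z_def intro!: scS less_imp_le)
  then obtain l \<rho> where l: "l \<in> S" and \<rho>: "strict_mono \<rho>" and lim: "(z \<circ> \<rho>) \<longlonglongrightarrow> l"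
    using \<open>seq_compact S\<close> unfolding seq_compact_def by metis
  have limz: "(\<lambda>p. z (\<rho> p) j) \<longlonglongrightarrow> l j" for j
    using lim by (simp add: tendsto_fun_iff o_def)
  \<comment> \<open>All corners of the cell at \<open>q\<close> tend to \<open>l\<close>, since its
    side is \<open>1 / Suc (\<rho> p)\<close>.\<close>
  have near: "(\<lambda>p. sc (Suc (\<rho> p)) (x p)) \<longlonglongrightarrow> l"
    if x: "\<And>p j. j < n \<Longrightarrow> q (\<rho> p) j \<le> x p j \<and> x p j \<le> q (\<rho> p) j + 1" for x
    unfolding tendsto_fun_iff
  proof
    fix j
    show "(\<lambda>p. sc (Suc (\<rho> p)) (x p) j) \<longlonglongrightarrow> l j"
    proof (rule tendsto_sandwich)
      show "(\<lambda>p. z (\<rho> p) j) \<longlonglongrightarrow> l j" by (rule limz)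
      have "(\<lambda>p. inverse (real (Suc (\<rho> p)))) \<longlonglongrightarrow> 0"
        using LIMSEQ_subseq_LIMSEQ[OF LIMSEQ_inverse_real_of_nat \<rho>] by (simp add: o_def)
      from tendsto_add[OF limz[of j] this]
      show "(\<lambda>p. z (\<rho> p) j + inverse (real (Suc (\<rho> p)))) \<longlonglongrightarrow> l j" by simp
      show "\<forall>\<^sub>F p in sequentially. z (\<rho> p) j \<le> sc (Suc (\<rho> p)) (x p) j"
        using x by (auto simp: z_def sc_def divide_right_mono)
      show "\<forall>\<^sub>F p in sequentially. sc (Suc (\<rho> p)) (x p) j \<le> z (\<rho> p) j + inverse (real (Suc (\<rho> p)))"
      proof (intro always_eventually allI)
        fix p
        show "sc (Suc (\<rho> p)) (x p) j \<le> z (\<rho> p) j + inverse (real (Suc (\<rho> p)))"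
        proof (cases "j < n")
          case True
          then have "real (x p j) \<le> real (q (\<rho> p) j) + 1" using x[of j p] by linarith
          then show ?thesis
            using True by (simp add: z_def sc_def divide_simps)
        qed (auto simp: z_def sc_def)
      qed
    qed
  qed
  have "g l i = l i" if i: "i < n" for i
  proof -
    \<comment> \<open>Two corners with different labels mean that both labels occur; each gives one
      of the two inequalities in the limit.\<close>
    have ex: "\<forall>p. \<exists>r. (\<forall>j<n. q p j \<le> r j \<and> r j \<le> q p j + 1) \<and> lab (sc (Suc p) r) i = b"
      if "b \<in> {0, 1}" for b
    proof
      fix p
      obtain r s where "\<forall>j<n. q p j \<le> r j \<and> r j \<le> q p j + 1" "\<forall>j<n. q p j \<le> s j \<and> s j \<le> q p j + 1"
          "lab (sc (Suc p) r) i \<noteq> lab (sc (Suc p) s) i"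
        using rs[OF i, of p] by blast
      moreover have "lab x i \<in> {0, 1}" for x by (simp add: lab_def)
      then have "lab (sc (Suc p) r) i = b \<or> lab (sc (Suc p) s) i = b"
        using calculation(3) that by (metis empty_iff insert_iff)
      ultimately show "\<exists>r. (\<forall>j<n. q p j \<le> r j \<and> r j \<le> q p j + 1) \<and> lab (sc (Suc p) r) i = b"
        by blast
    qed
    from choice[OF ex[of 0]] obtain r where
      r: "\<And>p j. j < n \<Longrightarrow> q p j \<le> r p j \<and> r p j \<le> q p j + 1" "\<And>p. lab (sc (Suc p) (r p)) i = 0"
      by blast
    from choice[OF ex[of 1]] obtain s where
      s: "\<And>p j. j < n \<Longrightarrow> q p j \<le> s p j \<and> s p j \<le> q p j + 1" "\<And>p. lab (sc (Suc p) (s p)) i = 1"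
      by blast
    have bound: "\<forall>j<n. x j \<le> Suc p" if "\<And>j. j < n \<Longrightarrow> x j \<le> q p j + 1" for x p
      using q[of _ p] that by fastforce
    have rS: "sc (Suc p) (r p) \<in> S" and sS: "sc (Suc p) (s p) \<in> S" for p
      using r(1) s(1) by (auto intro!: scS bound)
    have gto: "(\<lambda>p. g (x p) i) \<longlonglongrightarrow> g l i" if "x \<longlonglongrightarrow> l" "\<And>p. x p \<in> S" for x
      using continuous_on_tendsto_compose[OF cont[OF i] that(1) l] that(2) by simp
    have ito: "(\<lambda>p. x p i) \<longlonglongrightarrow> l i" if "x \<longlonglongrightarrow> l" for x
      using that by (simp add: tendsto_fun_iff)
    have limr: "(\<lambda>p. sc (Suc (\<rho> p)) (r (\<rho> p))) \<longlonglongrightarrow> l" and lims: "(\<lambda>p. sc (Suc (\<rho> p)) (s (\<rho> p))) \<longlonglongrightarrow> l"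
      using r(1) s(1) by (auto intro!: near)
    have "l i \<le> g l i"
    proof (rule LIMSEQ_le[OF ito[OF limr] gto[OF limr]])
      have "sc (Suc p) (r p) i \<le> g (sc (Suc p) (r p)) i" for p
        using r(2)[of p] maps[OF rS[of p] i] by (auto simp: lab_def split: if_splits)
      then show "\<exists>N. \<forall>p\<ge>N. sc (Suc (\<rho> p)) (r (\<rho> p)) i \<le> g (sc (Suc (\<rho> p)) (r (\<rho> p))) i"
        by blast
    qed (use rS in auto)
    moreover have "g l i \<le> l i"
    proof (rule LIMSEQ_le[OF gto[OF lims] ito[OF lims]])
      have "g (sc (Suc p) (s p)) i \<le> sc (Suc p) (s p) i" for p
        using s(2)[of p] maps[OF sS[of p] i] sS[of p] i by (fastforce simp: lab_def S_def split: if_splits)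
      then show "\<exists>N. \<forall>p\<ge>N. g (sc (Suc (\<rho> p)) (s (\<rho> p))) i \<le> sc (Suc (\<rho> p)) (s (\<rho> p)) i"
        by blast
    qed (use sS in auto)
    ultimately show ?thesis by simp
  qed
  with l show ?thesis by blast
qed

text \<open>The unknowns are weights on a finite \<open>\<epsilon>\<close>-net \<open>T\<close> of
  \<open>K\<close>, so Brouwer's theorem on a cube suffices. Weights are sent to the normalised tent
  functions of the net, evaluated at the image of their barycentre.\<close>

lemma schauder_approximate:
  fixes f :: "'a::real_normed_vector \<Rightarrow> 'a"
  assumes C: "convex C" and cont: "continuous_on C f"
    and K: "compact K" "K \<subseteq> C" "f ` C \<subseteq> K" "K \<noteq> {}" and \<epsilon>: "0 < \<epsilon>"
  shows "\<exists>x\<in>C. dist x (f x) \<le> \<epsilon>"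
proof -
  obtain T where T: "finite T" "T \<subseteq> K" "K \<subseteq> (\<Union>x\<in>T. ball x \<epsilon>)"
    using compactE_image[OF K(1), of K "\<lambda>x. ball x \<epsilon>"] \<epsilon> by (metis UN_I centre_in_ball open_ball subsetI)
  define n where "n = card T"
  obtain y where y: "bij_betw y {..<n} T"
    using ex_bij_betw_nat_finite[OF T(1)] by (auto simp: n_def atLeast0LessThan)
  have n: "0 < n"
    using T K(4) by (auto simp: n_def card_gt_0_iff)
  have yC: "y i \<in> C" if "i < n" for i
    using bij_betwE[OF y] T(2) K(2) that by auto
  define S where "S = {x::nat \<Rightarrow> real. (\<forall>i<n. 0 \<le> x i \<and> x i \<le> 1) \<and> (\<forall>i\<ge>n. x i = 0)}"
  \<comment> \<open>Barycentric weights, total on the cube (also where \<open>w\<close> sums to \<open>0\<close>) and equal to \<open>w\<close> when it sums to \<open>1\<close>.\<close>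
  define v where "v w i = (w i + (if i = 0 then max 0 (1 - sum w {..<n}) else 0)) / max 1 (sum w {..<n})"
    for w :: "nat \<Rightarrow> real" and i
  define c where "c w = (\<Sum>i<n. v w i *\<^sub>R y i)" for w
  have sumv: "sum (v w) {..<n} = 1" for w
  proof -
    have "(\<Sum>i<n. w i + (if i = 0 then max 0 (1 - sum w {..<n}) else 0)) = max 1 (sum w {..<n})"
      using n by (simp add: sum.distrib)
    then show ?thesis
      by (simp add: v_def flip: sum_divide_distrib)
  qed
  have cC: "c w \<in> C" if "w \<in> S" for w
    unfolding c_def
    by (rule convex_sum[OF _ C sumv]) (use that yC in \<open>auto simp: v_def S_def intro!: divide_nonneg_nonneg add_nonneg_nonneg\<close>)
  have contw: "continuous_on S (\<lambda>w. w i)" for i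
    by (rule continuous_on_subset[OF continuous_on_product_coordinates]) simp
  have contc: "continuous_on S c"
  proof -
    have "continuous_on S (\<lambda>w. if i = 0 then max 0 (1 - sum w {..<n}) else 0)" for i
      by (cases "i = 0") (auto intro!: continuous_intros contw)
    then show ?thesis
      unfolding c_def v_def by (intro continuous_intros contw) auto
  qed
  have contfc: "continuous_on S (\<lambda>w. f (c w))"
    using cC by (intro continuous_on_compose2[OF cont contc]) auto
  define h where "h x i = max 0 (\<epsilon> - dist (y i) x)" for x i
  have h0: "0 \<le> h x i" for x i by (simp add: h_def)
  have H: "0 < sum (h x) {..<n}" if "x \<in> K" for x
  proof -
    from that T(3) obtain t where "t \<in> T" "x \<in> ball t \<epsilon>" by blast
    then obtain i where "i < n" "dist (y i) x < \<epsilon>"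
      using y by (auto simp: bij_betw_def)
    then show ?thesis
      using h0 by (intro sum_pos2[of _ i]) (auto simp: h_def)
  qed
  have fcK: "f (c w) \<in> K" if "w \<in> S" for w using cC[OF that] K(3) by auto
  have "\<exists>w\<in>S. \<forall>i<n. h (f (c w)) i / sum (h (f (c w))) {..<n} = w i"
    unfolding S_def
  proof (rule brouwer_cube_nat, fold S_def)
    fix i assume i: "i < n"
    show "continuous_on S (\<lambda>w. h (f (c w)) i / sum (h (f (c w))) {..<n})"
      using H[OF fcK] unfolding h_def by (intro continuous_intros contfc) (auto simp: less_le)
    fix w assume "w \<in> S"
    with H[OF fcK[OF this]] h0 i
    show "0 \<le> h (f (c w)) i / sum (h (f (c w))) {..<n} \<and> h (f (c w)) i / sum (h (f (c w))) {..<n} \<le> 1"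
      by (auto simp: divide_le_eq_1 intro!: member_le_sum)
  qed
  then obtain w where w: "w \<in> S" and fix_w: "\<And>i. i < n \<Longrightarrow> h (f (c w)) i / sum (h (f (c w))) {..<n} = w i"
    by blast
  let ?x = "c w"
  have sw: "sum w {..<n} = 1"
  proof -
    have "sum w {..<n} = (\<Sum>i<n. h (f ?x) i / sum (h (f ?x)) {..<n})"
      using fix_w by simp
    also have "\<dots> = 1" using H[OF fcK[OF w]] by (simp flip: sum_divide_distrib)
    finally show ?thesis .
  qed
  then have v: "v w i = w i" for i by (simp add: v_def)
  have "?x - f ?x = (\<Sum>i<n. w i *\<^sub>R (y i - f ?x))"
    using sw by (simp add: c_def v scaleR_diff_right sum_subtractf flip: scaleR_sum_left)
  then have "norm (?x - f ?x) \<le> (\<Sum>i<n. norm (w i *\<^sub>R (y i - f ?x)))"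
    by (metis norm_sum)
  also have "\<dots> \<le> (\<Sum>i<n. w i * \<epsilon>)"
  proof (rule sum_mono)
    fix i assume "i \<in> {..<n}"
    then have i: "i < n" by simp
    show "norm (w i *\<^sub>R (y i - f ?x)) \<le> w i * \<epsilon>"
    \<comment> \<open>Only net points closer than \<open>\<epsilon>\<close> to \<open>f ?x\<close>
      carry weight, so the average also stays that close.\<close>
    proof (cases "w i = 0")
      case False
      then have "h (f ?x) i \<noteq> 0" using fix_w[OF i] by auto
      then have "norm (y i - f ?x) \<le> \<epsilon>" by (auto simp: h_def dist_norm max_def split: if_splits)
      moreover have "0 \<le> w i" using w i by (auto simp: S_def)
      ultimately show ?thesis by (simp add: mult_left_mono)
    qed auto
  qed
  also have "\<dots> = \<epsilon>" using sw by (simp flip: sum_distrib_right)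
  finally show ?thesis using cC[OF w] by (auto simp: dist_norm)
qed

text \<open>The images of ever better approximate fixed points have a convergent subsequence in
  \<open>K\<close>. The points themselves then have the same limit, which continuity makes
  fixed.\<close>

theorem schauder:
  fixes f :: "'a::real_normed_vector \<Rightarrow> 'a"
  assumes C: "convex C" "C \<noteq> {}" and cont: "continuous_on C f"
    and K: "compact K" "K \<subseteq> C" "f ` C \<subseteq> K"
  shows "\<exists>x\<in>C. f x = x"
proof -
  have "K \<noteq> {}" using C K by auto
  then have "\<exists>x\<in>C. dist x (f x) \<le> inverse (real (Suc i))" for i
    by (intro schauder_approximate[OF C(1) cont K]) auto
  then obtain x where x: "\<And>i. x i \<in> C" "\<And>i. dist (x i) (f (x i)) \<le> inverse (real (Suc i))"
    by metis
  have "\<forall>i. f (x i) \<in> K" using x K by auto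
  then obtain l \<rho> where l: "l \<in> K" and \<rho>: "strict_mono \<rho>" and lim: "((\<lambda>i. f (x i)) \<circ> \<rho>) \<longlonglongrightarrow> l"
    using compact_imp_seq_compact[OF K(1)] unfolding seq_compact_def by metis
  have to_0: "(\<lambda>i. inverse (real (Suc (\<rho> i)))) \<longlonglongrightarrow> 0"
    using LIMSEQ_subseq_LIMSEQ[OF LIMSEQ_inverse_real_of_nat \<rho>] by (simp add: o_def)
  have le: "norm (x (\<rho> i) - f (x (\<rho> i))) \<le> inverse (real (Suc (\<rho> i)))" for i
    using x(2) by (simp add: dist_norm)
  have "(\<lambda>i. x (\<rho> i) - f (x (\<rho> i))) \<longlonglongrightarrow> 0"
    by (rule Lim_null_comparison[OF _ to_0]) (simp add: le del: of_nat_Suc)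
  from tendsto_add[OF this lim[unfolded o_def]]
  have limx: "(\<lambda>i. x (\<rho> i)) \<longlonglongrightarrow> l"
    by simp
  have "(\<lambda>i. f (x (\<rho> i))) \<longlonglongrightarrow> f l"
    using continuous_on_tendsto_compose[OF cont limx] l K x by auto
  then have "f l = l" using lim LIMSEQ_unique by (auto simp: o_def)
  with l K show ?thesis by auto
qed

text \<open>Finite products of varying length are realised inside the normed space \<open>nat \<Rightarrow>\<^sub>C 'a\<close>.\<close>

definition bcontfun_single :: "nat \<Rightarrow> 'a::real_normed_vector \<Rightarrow> nat \<Rightarrow>\<^sub>C 'a" where
  "bcontfun_single i x = Bcontfun (\<lambda>j. if j = i then x else 0)"

lemma apply_bcontfun_single: "apply_bcontfun (bcontfun_single i x) j = (if j = i then x else 0)"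
proof -
  have "(\<lambda>j. if j = i then x else 0) \<in> bcontfun"
    by (rule bcontfun_normI[of _ "norm x"]) (auto intro: continuous_on_discrete)
  then show ?thesis by (simp add: bcontfun_single_def Bcontfun_inverse)
qed

lemma bounded_linear_bcontfun_single: "bounded_linear (bcontfun_single i)"
proof (rule bounded_linear_intro[where K = 1])
  fix x y :: 'a and c :: real
  show "bcontfun_single i (x + y) = bcontfun_single i x + bcontfun_single i y"
    "bcontfun_single i (c *\<^sub>R x) = c *\<^sub>R bcontfun_single i x"
    by (auto intro!: bcontfun_eqI simp: apply_bcontfun_single)
  show "norm (bcontfun_single i x) \<le> norm x * 1"
    by (auto intro!: norm_bound simp: apply_bcontfun_single)
qed

lemma apply_bcontfun_sum: "apply_bcontfun (sum f A) x = (\<Sum>i\<in>A. apply_bcontfun (f i) x)"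
  by (induction A rule: infinite_finite_induct) auto

lemma apply_sum_bcontfun_single:
  "apply_bcontfun (\<Sum>i<m. bcontfun_single i (x i)) j = (if j < m then x j else 0)"
  by (simp add: apply_bcontfun_sum apply_bcontfun_single)

lemma continuous_on_bcontfun_eval: "continuous_on S (\<lambda>f. apply_bcontfun f x)"
proof (rule continuous_on_iff[THEN iffD2], intro ballI allI impI)
  fix f e assume "0 < (e::real)"
  then show "\<exists>d>0. \<forall>g\<in>S. dist g f < d \<longrightarrow> dist (apply_bcontfun g x) (apply_bcontfun f x) < e"
    by (intro exI[of _ e]) (auto intro: dist_fun_lt_imp_dist_val_lt)
qed

text \<open>The number \<open>m\<close> of factors is a term. \<open>D\<close> leaves the
  coordinates from \<open>m\<close> on free, and \<open>\<Phi>\<close> sets them to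
  \<open>0\<close>.\<close>

theorem schauder_finite_product:
  fixes \<phi> :: "nat \<Rightarrow> (nat \<Rightarrow> 'a::real_normed_vector) \<Rightarrow> 'a"
  assumes convex: "\<And>i. i < m \<Longrightarrow> convex (C i)" and ne: "\<And>i. i < m \<Longrightarrow> C i \<noteq> {}"
    and cont: "\<And>i. i < m \<Longrightarrow> continuous_on {x. \<forall>i<m. x i \<in> C i} (\<phi> i)"
    and K: "\<And>i. i < m \<Longrightarrow> compact (K i)" "\<And>i. i < m \<Longrightarrow> K i \<subseteq> C i"
      "\<And>i x. i < m \<Longrightarrow> \<forall>j<m. x j \<in> C j \<Longrightarrow> \<phi> i x \<in> K i"
  shows "\<exists>x. (\<forall>i<m. x i \<in> C i) \<and> (\<forall>i<m. \<phi> i x = x i)"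
proof -
  define D where "D = {f. \<forall>i<m. apply_bcontfun f i \<in> C i}"
  define sing where "sing x = (\<Sum>i<m. bcontfun_single i (x i))" for x :: "nat \<Rightarrow> 'a"
  define \<Phi> where "\<Phi> f = sing (\<lambda>i. \<phi> i (apply_bcontfun f))" for f
  have sing: "apply_bcontfun (sing x) i = x i" if "i < m" for i x
    using that by (simp add: sing_def apply_sum_bcontfun_single)
  define c where "c i = (SOME z. z \<in> C i)" for i
  have c: "c i \<in> C i" if "i < m" for i
    unfolding c_def using ne[OF that] by (simp add: some_in_eq)
  \<comment> \<open>A set of finite sums, built up by one compact Minkowski summand at a time; for
    \<open>n = m\<close> it contains the range of \<open>\<Phi>\<close>.\<close>
  have compact: "compact {\<Sum>i<n. bcontfun_single i (x i) |x. \<forall>i<n. x i \<in> K i}" if "n \<le> m" for n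
    using that
  proof (induction n)
    case (Suc n)
    let ?A = "{\<Sum>i<n. bcontfun_single i (x i) |x. \<forall>i<n. x i \<in> K i}"
    have "{\<Sum>i<Suc n. bcontfun_single i (x i) |x. \<forall>i<Suc n. x i \<in> K i}
        = {y + z |y z. y \<in> ?A \<and> z \<in> bcontfun_single n ` K n}"
    proof (intro equalityI subsetI)
      fix y assume "y \<in> {y + z |y z. y \<in> ?A \<and> z \<in> bcontfun_single n ` K n}"
      then obtain x z where "\<forall>i<n. x i \<in> K i" "z \<in> K n"
        "y = (\<Sum>i<n. bcontfun_single i (x i)) + bcontfun_single n z" by auto
      then show "y \<in> {\<Sum>i<Suc n. bcontfun_single i (x i) |x. \<forall>i<Suc n. x i \<in> K i}"
        by (intro CollectI exI[of _ "x(n := z)"]) (auto simp: less_Suc_eq)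
    qed fastforce
    moreover have "compact (bcontfun_single n ` K n)"
      using Suc.prems K(1) by (intro compact_continuous_image linear_continuous_on bounded_linear_bcontfun_single) auto
    moreover have "compact ?A" using Suc by simp
    ultimately show ?case
      using compact_sums[of ?A "bcontfun_single n ` K n"] by (simp only:)
  qed auto
  have "\<exists>f\<in>D. \<Phi> f = f"
  proof (rule schauder)
    show "convex D"
      using convex by (auto simp: D_def convex_def)
    show "D \<noteq> {}"
      using c sing by (auto simp: D_def intro!: exI[of _ "sing c"])
    show "compact {\<Sum>i<m. bcontfun_single i (x i) |x. \<forall>i<m. x i \<in> K i}"
      by (rule compact) simp
    show "{\<Sum>i<m. bcontfun_single i (x i) |x. \<forall>i<m. x i \<in> K i} \<subseteq> D"
      using K(2) by (fastforce simp: D_def apply_sum_bcontfun_single)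
    show "\<Phi> ` D \<subseteq> {\<Sum>i<m. bcontfun_single i (x i) |x. \<forall>i<m. x i \<in> K i}"
      using K(3) by (auto simp: D_def \<Phi>_def sing_def)
    have "continuous_on D (\<lambda>f. \<phi> i (apply_bcontfun f))" if "i < m" for i
      by (rule continuous_on_compose2[OF cont[OF that]])
         (auto simp: D_def intro: continuous_on_coordinatewise_then_product continuous_on_bcontfun_eval)
    then show "continuous_on D \<Phi>"
      unfolding \<Phi>_def sing_def
      by (intro continuous_on_sum bounded_linear.continuous_on[OF bounded_linear_bcontfun_single]) auto
  qed
  then obtain f where f: "f \<in> D" "\<Phi> f = f" by blast
  show ?thesis
  proof (intro exI[of _ "apply_bcontfun f"] conjI allI impI)
    fix i assume i: "i < m"
    show "apply_bcontfun f i \<in> C i" using f(1) i by (simp add: D_def)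
    show "\<phi> i (apply_bcontfun f) = apply_bcontfun f i"
      using sing[OF i, of "\<lambda>i. \<phi> i (apply_bcontfun f)"] f(2) by (simp add: \<Phi>_def)
  qed
qed

section \<open>Closed chains of coverings\<close>

lemma covering_loop_fixed_point:
  fixes F :: "real \<times> 'c::real_normed_vector \<Rightarrow> real \<times> 'c" and m :: nat
  assumes m: "0 < m" and C: "convex C" "C \<noteq> {}"
    and cont: "continuous_on (I \<times> C) F"
    and K: "compact K" "K \<subseteq> C" "\<And>x. x \<in> I \<times> C \<Longrightarrow> snd (F x) \<in> K"
    and J: "\<And>i. i < m \<Longrightarrow> \<alpha> i \<le> \<beta> i" "\<And>i. i < m \<Longrightarrow> {\<alpha> i..\<beta> i} \<subseteq> I"
    and cover: "\<And>i. i < m \<Longrightarrow>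
      (\<forall>z\<in>C. fst (F (\<alpha> i, z)) < \<alpha> (Suc i mod m) \<and> \<beta> (Suc i mod m) < fst (F (\<beta> i, z))) \<or>
      (\<forall>z\<in>C. fst (F (\<beta> i, z)) < \<alpha> (Suc i mod m) \<and> \<beta> (Suc i mod m) < fst (F (\<alpha> i, z)))"
  shows "\<exists>x. (\<forall>i<m. (F ^^ i) x \<in> {\<alpha> i..\<beta> i} \<times> C) \<and> (F ^^ m) x = x"
proof -
  let ?s = "\<lambda>i. Suc i mod m" and ?p = "\<lambda>i. (i + m - 1) mod m"
  have s: "?s i < m" and p: "?p i < m" for i using m by auto
  have ps: "?p (?s i) = i" if "i < m" for i
    using that m by (cases "Suc i = m") auto
  define incr where "incr i \<longleftrightarrow> (\<forall>z\<in>C. fst (F (\<alpha> i, z)) < \<alpha> (?s i) \<and> \<beta> (?s i) < fst (F (\<beta> i, z)))" for i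
  \<comment> \<open>The orientation of the covering. With this sign the correction in
    \<open>\<tau>\<close> points inwards at both ends of the interval.\<close>
  define \<sigma> where "\<sigma> i = (if incr i then 1 else - 1 :: real)" for i
  define \<tau> where "\<tau> i x = fst (x i) - \<sigma> i * (fst (F (x i)) - fst (x (?s i)))" for i and x :: "nat \<Rightarrow> real \<times> 'c"
  \<comment> \<open>The second component is taken from the predecessor, so a fixed point satisfies
    \<open>F (x i) = x (?s i)\<close> there at once. The first component needs the clamp to be
    inactive.\<close>
  define \<phi> where "\<phi> i x = (max (\<alpha> i) (min (\<beta> i) (\<tau> i x)), snd (F (x (?p i))))" for i x
  let ?C = "\<lambda>i. {\<alpha> i..\<beta> i} \<times> C"
  let ?S = "{x. \<forall>i<m. x i \<in> ?C i}"
  have "\<exists>x. (\<forall>i<m. x i \<in> ?C i) \<and> (\<forall>i<m. \<phi> i x = x i)"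
  proof (rule schauder_finite_product[where K = "\<lambda>i. {\<alpha> i..\<beta> i} \<times> K"])
    fix i assume i: "i < m"
    show "convex (?C i)" using C by (intro convex_Times) auto
    show "?C i \<noteq> {}" using C J(1)[OF i] by auto
    show "compact ({\<alpha> i..\<beta> i} \<times> K)" using K by (intro compact_Times) auto
    show "{\<alpha> i..\<beta> i} \<times> K \<subseteq> ?C i" using K by auto
    have contx: "continuous_on ?S (\<lambda>x. x j)" for j
      by (rule continuous_on_subset[OF continuous_on_product_coordinates]) simp
    have contF: "continuous_on ?S (\<lambda>x. F (x j))" if "j < m" for j
      using that J(2)[OF that] by (intro continuous_on_compose2[OF cont contx]) fastforce
    show "continuous_on ?S (\<phi> i)"
      unfolding \<phi>_def \<tau>_def
      by (intro continuous_intros contx contF i p)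
    fix x assume x: "\<forall>j<m. x j \<in> ?C j"
    then have "x (?p i) \<in> I \<times> C"
      using J(2)[OF p[of i]] p[of i] by (metis mem_Times_iff subsetD)
    then show "\<phi> i x \<in> {\<alpha> i..\<beta> i} \<times> K"
      using K(3) J(1)[OF i] by (auto simp: \<phi>_def)
  qed
  then obtain x where x: "\<And>i. i < m \<Longrightarrow> x i \<in> ?C i" and fix_x: "\<And>i. i < m \<Longrightarrow> \<phi> i x = x i"
    by blast
  have step: "F (x i) = x (?s i)" if i: "i < m" for i
  proof (rule prod_eqI)
    show "snd (F (x i)) = snd (x (?s i))"
      using arg_cong[OF fix_x[OF s[of i]], of snd] ps[OF i] by (simp add: \<phi>_def)
    obtain t z where tz: "x i = (t, z)" by fastforce
    have t: "t \<in> {\<alpha> i..\<beta> i}" "z \<in> C" using x[OF i] tz by auto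
    have u: "\<alpha> (?s i) \<le> fst (x (?s i))" "fst (x (?s i)) \<le> \<beta> (?s i)" using x[OF s[of i]] by auto
    have clamp: "max (\<alpha> i) (min (\<beta> i) (\<tau> i x)) = t"
      using arg_cong[OF fix_x[OF i], of fst] tz by (simp add: \<phi>_def)
    have \<tau>: "\<tau> i x = t - \<sigma> i * (fst (F (t, z)) - fst (x (?s i)))"
      using tz by (simp add: \<tau>_def)
    consider "\<sigma> i = 1" "\<forall>z\<in>C. fst (F (\<alpha> i, z)) < \<alpha> (?s i) \<and> \<beta> (?s i) < fst (F (\<beta> i, z))"
      | "\<sigma> i = - 1" "\<forall>z\<in>C. fst (F (\<beta> i, z)) < \<alpha> (?s i) \<and> \<beta> (?s i) < fst (F (\<alpha> i, z))"
      using cover[OF i] by (cases "incr i") (auto simp: \<sigma>_def, auto simp: incr_def)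
    then have "\<tau> i x = t"
    proof cases
      case 1
      have "t = \<alpha> i \<Longrightarrow> t < \<tau> i x" "t = \<beta> i \<Longrightarrow> \<tau> i x < t"
        using 1 t u \<tau> by fastforce+
      then show ?thesis using clamp t by (auto simp: max_def min_def split: if_splits)
    next
      case 2
      have "t = \<alpha> i \<Longrightarrow> t < \<tau> i x" "t = \<beta> i \<Longrightarrow> \<tau> i x < t"
        using 2 t u \<tau> by fastforce+
      then show ?thesis using clamp t by (auto simp: max_def min_def split: if_splits)
    qed
    then show "fst (F (x i)) = fst (x (?s i))"
      using \<tau> tz by (auto simp: \<sigma>_def split: if_splits)
  qed
  have iter: "(F ^^ i) (x 0) = x (i mod m)" if "i \<le> m" for i
    using that
  proof (induction i)
    case (Suc i)
    then show ?case using step[of i] by simp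
  qed simp
  show ?thesis
    using iter x m by (intro exI[of _ "x 0"]) auto
qed

section \<open>Chains forced by a cycle\<close>

definition hull2 :: "'a::linorder \<Rightarrow> 'a \<Rightarrow> 'a \<times> 'a" where
  "hull2 x y = (min x y, max x y)"

definition covers :: "('a::linorder \<Rightarrow> 'a) \<Rightarrow> 'a \<times> 'a \<Rightarrow> 'a \<times> 'a \<Rightarrow> bool" where
  "covers \<sigma> A B \<longleftrightarrow> min (\<sigma> (fst A)) (\<sigma> (snd A)) \<le> fst B \<and> snd B \<le> max (\<sigma> (fst A)) (\<sigma> (snd A))"

text \<open>The absence of proper invariant subsets says that \<open>S\<close> is a single cycle (or empty).\<close>

definition cycle_on :: "'a set \<Rightarrow> ('a \<Rightarrow> 'a) \<Rightarrow> bool" where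
  "cycle_on S \<sigma> \<longleftrightarrow> finite S \<and> \<sigma> ` S \<subseteq> S \<and> (\<forall>A\<subseteq>S. A \<noteq> {} \<longrightarrow> \<sigma> ` A \<subseteq> A \<longrightarrow> A = S)"

text \<open>A pair \<open>(u, v)\<close> stands for the interval from \<open>u\<close> to \<open>v\<close>. Only the images of end points matter for
  coverings, so other points of \<open>S\<close> may lie inside. The last clause forces the least period to
  be \<open>l\<close>.\<close>

definition elementary_loop ::
  "'a::linorder set \<Rightarrow> ('a \<Rightarrow> 'a) \<Rightarrow> nat \<Rightarrow> (nat \<Rightarrow> 'a \<times> 'a) \<Rightarrow> bool" where
  "elementary_loop S \<sigma> l A \<longleftrightarrow>
     0 < l \<and> A l = A 0 \<and>
     (\<forall>i<l. fst (A i) \<in> S \<and> snd (A i) \<in> S \<and> fst (A i) < snd (A i) \<and> covers \<sigma> (A i) (A (Suc i))) \<and>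
     (\<forall>i. 0 < i \<and> i < l \<longrightarrow> snd (A i) \<le> fst (A 0) \<or> snd (A 0) \<le> fst (A i))"

lemma covers_hull2:
  "covers \<sigma> (hull2 a b) (hull2 c d) \<longleftrightarrow>
     min (\<sigma> a) (\<sigma> b) \<le> min c d \<and> max c d \<le> max (\<sigma> a) (\<sigma> b)"
  by (auto simp: covers_def hull2_def min_def max_def)

lemma cycle_onD:
  assumes "cycle_on S \<sigma>"
  shows "finite S" "\<And>x. x \<in> S \<Longrightarrow> \<sigma> x \<in> S"
    "\<And>A. A \<subseteq> S \<Longrightarrow> A \<noteq> {} \<Longrightarrow> \<sigma> ` A \<subseteq> A \<Longrightarrow> A = S"
  using assms by (auto simp: cycle_on_def)

lemma cycle_on_inj:
  assumes "cycle_on S \<sigma>"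
  shows "inj_on \<sigma> S"
proof (cases "S = {}")
  case False
  have "\<sigma> ` S = S"
    using cycle_onD[OF assms] False by (intro cycle_onD(3)[OF assms]) auto
  then show ?thesis
    using cycle_onD(1)[OF assms] by (simp add: eq_card_imp_inj_on)
qed auto

lemma cycle_on_no_fixpoint:
  assumes "cycle_on S \<sigma>" "2 \<le> card S" "x \<in> S"
  shows "\<sigma> x \<noteq> x"
proof
  assume "\<sigma> x = x"
  then have "{x} = S"
    using assms(3) by (intro cycle_onD(3)[OF assms(1)]) auto
  then have "card S = card {x}" by simp
  then show False
    using assms(2) by simp
qed

text \<open>\<open>p\<close> is the last point that moves to the right and \<open>q\<close> the next
  point of \<open>S\<close>. Hence \<open>q\<close> moves left, and it must jump the gap.\<close>

lemma cycle_on_center: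
  fixes S :: "'a::linorder set"
  assumes cyc: "cycle_on S \<sigma>" and card: "2 \<le> card S"
  obtains p q where "p \<in> S" "q \<in> S" "p < q" "\<And>x. x \<in> S \<Longrightarrow> x \<le> p \<or> q \<le> x"
    "q \<le> \<sigma> p" "\<sigma> q \<le> p"
proof -
  note fin = cycle_onD(1)[OF cyc] and clo = cycle_onD(2)[OF cyc]
  note nofix = cycle_on_no_fixpoint[OF cyc card]
  have ne: "S \<noteq> {}" using card by auto
  define P where "P = {x \<in> S. x < \<sigma> x}"
  define p where "p = Max P"
  have "Min S \<in> P"
    using Min_in[OF fin ne] Min_le[OF fin clo] nofix[of "Min S"] by (force simp: P_def less_le)
  moreover have "finite P" using fin by (simp add: P_def)
  ultimately have p: "p \<in> P" and pmax: "\<And>x. x \<in> P \<Longrightarrow> x \<le> p"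
    unfolding p_def by (metis Max_in empty_iff, metis Max_ge)
  define Q where "Q = {x \<in> S. p < x}"
  define q where "q = Min Q"
  have "\<sigma> p \<in> Q"
    using p clo by (auto simp: P_def Q_def)
  moreover have "finite Q" using fin by (simp add: Q_def)
  ultimately have q: "q \<in> Q" and qmin: "\<And>x. x \<in> Q \<Longrightarrow> q \<le> x"
    unfolding q_def by (metis Min_in empty_iff, metis Min_le)
  have "\<not> q < \<sigma> q"
    using pmax[of q] q by (auto simp: P_def Q_def)
  then have "\<sigma> q < q"
    using nofix[of q] q by (auto simp: Q_def)
  then have "\<sigma> q \<le> p"
    using qmin[of "\<sigma> q"] q clo by (force simp: Q_def)
  with p q qmin \<open>\<sigma> p \<in> Q\<close> show ?thesis
    by (intro that[of p q]) (auto simp: P_def Q_def not_less[symmetric])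
qed

text \<open>Along a shortest path \<open>f\<close> from the centre to a staying point, the intervals
  \<open>I i\<close> from \<open>f i\<close> across the central gap cover one another in turn. The
  outermost interval \<open>J\<close> covers enough of them to close loops, which are elementary
  because they pass through \<open>J\<close> once.\<close>

lemma elementary_loop_if_not_all_switch:
  fixes S :: "'a::linorder set"
  assumes cyc: "cycle_on S \<sigma>"
    and pq: "p \<in> S" "q \<in> S" "p < q" "\<And>x. x \<in> S \<Longrightarrow> x \<le> p \<or> q \<le> x" "q \<le> \<sigma> p" "\<sigma> q \<le> p"
    and stay: "\<exists>x\<in>S. x \<le> p \<longleftrightarrow> \<sigma> x \<le> p"
    and l: "2 \<le> l" "even l \<or> card S < l"
  shows "\<exists>A. elementary_loop S \<sigma> l A"
proof -
  note fin = cycle_onD(1)[OF cyc] and clo = cycle_onD(2)[OF cyc]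
  define r where "r = {(x, y). x \<in> S \<and> y \<in> S \<and>
     (x \<le> p \<and> q \<le> y \<and> y \<le> \<sigma> x \<or> q \<le> x \<and> y \<le> p \<and> \<sigma> x \<le> y)}"
  \<comment> \<open>\<open>(x, y) \<in> r\<close>: \<open>\<sigma>\<close> carries \<open>x\<close> across the centre to \<open>y\<close> or beyond. Minimality of a path from the centre
     to a staying point forces its vertices on either side to move strictly outwards.\<close>
  define Reach where "Reach k \<longleftrightarrow> (\<exists>x\<in>{p, q}. \<exists>y. (x, y) \<in> r ^^ k \<and> (y \<le> p \<longleftrightarrow> \<sigma> y \<le> p))" for k
  \<comment> \<open>If only switching points were reachable, \<open>\<sigma> y\<close> would be an
    \<open>r\<close>-successor of each reachable \<open>y\<close>. The reachable set would be
    invariant, hence all of \<open>S\<close>.\<close>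
  have "\<exists>y \<in> r\<^sup>* `` {p, q}. y \<le> p \<longleftrightarrow> \<sigma> y \<le> p"
  proof (rule ccontr)
    assume no: "\<not> ?thesis"
    have sub: "r\<^sup>* `` {p, q} \<subseteq> S"
    proof
      fix y assume "y \<in> r\<^sup>* `` {p, q}"
      then obtain x where "x \<in> {p, q}" "(x, y) \<in> r\<^sup>*" by auto
      from this(2,1) show "y \<in> S"
        by (induction rule: rtrancl_induct) (auto simp: r_def pq)
    qed
    have "\<sigma> ` (r\<^sup>* `` {p, q}) \<subseteq> r\<^sup>* `` {p, q}"
    proof (rule image_subsetI)
      fix y assume y: "y \<in> r\<^sup>* `` {p, q}"
      have yS: "y \<in> S" and "y \<le> p \<longleftrightarrow> \<not> \<sigma> y \<le> p"
        using y no sub by blast+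
      then have "(y, \<sigma> y) \<in> r"
        using clo[OF yS] pq(4)[OF yS] pq(4)[OF clo[OF yS]] unfolding r_def by auto
      with y show "\<sigma> y \<in> r\<^sup>* `` {p, q}"
        by (meson Image_iff rtrancl.rtrancl_into_rtrancl)
    qed
    then have "r\<^sup>* `` {p, q} = S"
      using sub by (intro cycle_onD(3)[OF cyc]) auto
    with no stay show False by blast
  qed
  then have ex: "\<exists>k. Reach k"
    unfolding Reach_def by (auto dest!: rtrancl_imp_relpow)
  define k where "k = (LEAST k. Reach k)"
  have minimal: "\<not> Reach k'" if "k' < k" for k'
    using that not_less_Least unfolding k_def by blast
  have "Reach k"
    unfolding k_def using ex by (rule LeastI_ex)
  then obtain f where f0: "f 0 \<in> {p, q}" and step: "\<And>i. i < k \<Longrightarrow> (f i, f (Suc i)) \<in> r"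
    and fk: "f k \<le> p \<longleftrightarrow> \<sigma> (f k) \<le> p"
    unfolding Reach_def by (auto simp: relpow_fun_conv)
  have k: "0 < k"
    using f0 fk pq by (cases k) auto
  have seg: "(f i, f j) \<in> r ^^ (j - i)" if "i \<le> j" "j \<le> k" for i j
    unfolding relpow_fun_conv using that step by (intro exI[of _ "\<lambda>m. f (i + m)"]) auto
  have fS: "f i \<in> S" if "i \<le> k" for i
  proof (cases i)
    case (Suc j)
    then show ?thesis using step[of j] that by (auto simp: r_def)
  qed (use f0 pq in auto)
  \<comment> \<open>Otherwise the rest of the path would be a shorter one from the centre.\<close>
  have ncenter: "f i \<notin> {p, q}" if "0 < i" "i \<le> k" for i
    using minimal[of "k - i"] seg[of i k] fk that unfolding Reach_def by fastforce
  have nshort: "(f i, f j) \<notin> r" if "Suc i < j" "j \<le> k" for i j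
  proof
    assume "(f i, f j) \<in> r"
    then have "(f 0, f j) \<in> r ^^ Suc i"
      using seg[of 0 i] that by auto
    then have "(f 0, f k) \<in> r ^^ (Suc i + (k - j))"
      unfolding relpow_add using seg[of j k] that by (intro relcompI) auto
    then show False
      using minimal[of "Suc i + (k - j)"] f0 fk that unfolding Reach_def by fastforce
  qed
  have inj: "inj_on f {..k}"
  proof (rule linorder_inj_onI)
    fix i j assume ij: "i < j" "i \<in> {..k}" "j \<in> {..k}"
    show "f i \<noteq> f j"
    proof
      assume "f i = f j"
      then have "(f 0, f k) \<in> r ^^ (i + (k - j))"
        unfolding relpow_add using seg[of 0 i] seg[of j k] ij by (auto intro: relcompI)
      then show False
        using minimal[of "i + (k - j)"] f0 fk ij unfolding Reach_def by fastforce
    qed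
  qed auto
  \<comment> \<open>The path has \<open>k + 1\<close> distinct vertices, so
    \<open>card S < l\<close> yields \<open>k < l\<close>.\<close>
  have "card (f ` {..k}) \<le> card S"
    using fin fS by (intro card_mono) auto
  then have kl: "even l \<or> k < l"
    using l(2) inj by (auto simp: card_image)
  have side: "f i \<le> p \<longleftrightarrow> (even i \<longleftrightarrow> f 0 \<le> p)" if "i \<le> k" for i
    using that
  proof (induction i)
    case (Suc i)
    then show ?case using step[of i] pq(3) by (auto simp: r_def)
  qed auto
  have side': "q \<le> f i \<longleftrightarrow> \<not> f i \<le> p" if "i \<le> k" for i
    using pq(3) pq(4)[OF fS[OF that]] by auto
  \<comment> \<open>For \<open>0 < i\<close>, the image of the predecessor of \<open>f i\<close>
    reaches \<open>f i\<close> but falls short of \<open>f j\<close>, since an arrow to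
    \<open>f j\<close> would be a shortcut. For \<open>i = 0\<close>, \<open>ncenter\<close>
    applies.\<close>
  have out: "(f i \<le> p \<longrightarrow> f j < f i) \<and> (q \<le> f i \<longrightarrow> f i < f j)"
    if ij: "i < j" "j \<le> k" "even (j - i)" for i j
  proof (cases i)
    case 0
    then show ?thesis
      using f0 ncenter[of j] side[of j] side'[of j] ij pq(3) by auto
  next
    case (Suc m)
    have "even j \<longleftrightarrow> even i" using ij by auto
    then have "f j \<le> p \<longleftrightarrow> f i \<le> p"
      using side[of i] side[of j] ij by auto
    then show ?thesis
      using nshort[of m j] step[of m] side'[of i] side'[of j] ij Suc fS[of j] pq(3)
      by (auto simp: r_def)
  qed
  define e where "e i = (if f i \<le> p then q else p)" for i
  \<comment> \<open>The inner end of \<open>J\<close>: the preceding vertex on the side of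
    \<open>f k\<close>, or for \<open>k = 1\<close> the end of the central gap on that side.\<close>
  define g where "g = (if k = 1 then e 0 else f (k - 2))"
  define I where "I i = hull2 (f i) (e i)" for i
  define J where "J = hull2 (f k) g"
  have eS: "e i \<in> S" for i using pq by (auto simp: e_def)
  have gS: "g \<in> S" using eS fS by (auto simp: g_def)
  have gside: "g \<le> p \<longleftrightarrow> f k \<le> p"
  proof (cases "k = 1")
    case True
    then show ?thesis using side[of 1] pq(3) by (auto simp: g_def e_def)
  next
    case False
    then have "even (k - 2) = even k" using k by (cases k) auto
    with False show ?thesis using side[of k] side[of "k - 2"] by (auto simp: g_def)
  qed
  have gside': "q \<le> g \<longleftrightarrow> \<not> g \<le> p"
    using pq(3) pq(4)[OF gS] by auto
  have gout: "(f k \<le> p \<longrightarrow> f k < g) \<and> (q \<le> f k \<longrightarrow> g < f k)"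
  proof (cases "k = 1")
    case True
    then show ?thesis
      using ncenter[of 1] gside side[of 1] side'[of 1] k pq(3) by (auto simp: g_def e_def split: if_splits)
  next
    case False
    then have "k - 2 < k" "even (k - (k - 2))" using k by auto
    with False show ?thesis
      using out[of "k - 2" k] gside gside' by (auto simp: g_def side')
  qed
  \<comment> \<open>\<open>g\<close> is sent across to \<open>f (k - 1)\<close> or beyond, while
    \<open>f k\<close> stays on its side. So \<open>J\<close> covers everything from the centre
    point on the side of \<open>f k\<close> to \<open>f (k - 1)\<close>.\<close>
  have \<sigma>g: "(f k \<le> p \<longrightarrow> f (k - 1) \<le> \<sigma> g) \<and> (q \<le> f k \<longrightarrow> \<sigma> g \<le> f (k - 1))"
  proof (cases "k = 1")
    case True
    then show ?thesis using f0 gside gside' pq by (auto simp: g_def e_def side' split: if_splits)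
  next
    case False
    then have "Suc (k - 2) = k - 1" "k - 2 < k" using k by auto
    with False show ?thesis
      using step[of "k - 2"] gside gside' pq(3) by (auto simp: g_def r_def side')
  qed
  have covI: "covers \<sigma> (I i) (I (Suc i))" if "Suc i \<le> k" for i
    using step[of i] that pq by (auto simp: I_def covers_hull2 r_def e_def min_def max_def)
  have cov0: "covers \<sigma> (I 0) (I 0)"
    using f0 pq by (auto simp: I_def covers_hull2 e_def min_def max_def)
  \<comment> \<open>The covered stretch contains the central interval and every \<open>I j\<close>
    with \<open>f j\<close> on the side of \<open>f (k - 1)\<close>.\<close>
  have covJ: "covers \<sigma> J (I j)" if j: "j < k" "j = 0 \<or> even (k - 1 - j)" for j
  proof -
    have *: "(q \<le> f (k - 1) \<longrightarrow> p \<le> f j \<and> f j \<le> f (k - 1)) \<and> (f (k - 1) \<le> p \<longrightarrow> f (k - 1) \<le> f j \<and> f j \<le> q)"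
    proof -
      consider "j = k - 1" | "j < k - 1" "even (k - 1 - j)" | "j = 0" "odd (k - 1)" using j by force
      then show ?thesis
      proof cases
        case 1
        then show ?thesis using pq(3) by auto
      next
        case 2
        then have "f j \<le> p \<longleftrightarrow> f (k - 1) \<le> p"
          using side[of j] side[of "k - 1"] by auto
        with 2 show ?thesis
          using out[of j "k - 1"] side'[of j] side'[of "k - 1"] j pq(3) by auto
      next
        case 3
        then show ?thesis using f0 side[of "k - 1"] side'[of "k-1"] pq(3) by auto
      qed
    qed
    have k1: "f (k - 1) \<le> p \<longleftrightarrow> \<not> f k \<le> p"
      using side[of k] side[of "k - 1"] k by auto
    show ?thesis
    proof (cases "f k \<le> p")
      case True
      then have "\<sigma> (f k) \<le> p" "q \<le> f (k - 1)" "f (k - 1) \<le> \<sigma> g"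
        using fk k1 side'[of "k - 1"] \<sigma>g by auto
      moreover have "p \<le> min (f j) (e j)" "max (f j) (e j) \<le> f (k - 1)"
        using * \<open>q \<le> f (k - 1)\<close> pq(3) by (auto simp: e_def)
      ultimately show ?thesis
        unfolding I_def J_def covers_hull2 by (meson min.coboundedI1 max.coboundedI2 order.trans)
    next
      case False
      then have "q \<le> \<sigma> (f k)" "f (k - 1) \<le> p" "\<sigma> g \<le> f (k - 1)"
        using fk k1 side'[of k] \<sigma>g pq(4)[OF clo[OF fS[of k]]] by auto
      moreover have "f (k - 1) \<le> min (f j) (e j)" "max (f j) (e j) \<le> q"
        using * \<open>f (k - 1) \<le> p\<close> pq(3) by (auto simp: e_def)
      ultimately show ?thesis
        unfolding I_def J_def covers_hull2 by (meson min.coboundedI2 max.coboundedI1 order.trans)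
    qed
  qed
  have covIJ: "covers \<sigma> (I (k - 1)) J"
    using step[of "k - 1"] k gside gside' gout pq
    by (auto simp: I_def J_def covers_hull2 r_def e_def min_def max_def)
  \<comment> \<open>On the side of \<open>f k\<close>, each \<open>I j\<close> ends at
    \<open>g\<close> or before it, so it shares at most an end point with \<open>J\<close>.\<close>
  have disj: "snd (I j) \<le> fst J \<or> snd J \<le> fst (I j)" if "j < k" for j
  proof (cases "f j \<le> p \<longleftrightarrow> f k \<le> p")
    case True
    then have "even (k - j)" using side[of j] side[of k] that by auto
    then have "j \<le> k - 2" "k \<noteq> 1" using that by presburger+
    then have "j = k - 2 \<or> j < k - 2 \<and> even (k - 2 - j)" using \<open>even (k - j)\<close> that by presburger
    then have "(g \<le> p \<longrightarrow> g \<le> f j) \<and> (q \<le> g \<longrightarrow> f j \<le> g)"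
      using \<open>k \<noteq> 1\<close> out[of j "k - 2"] True gside gside' side'[of j] that by (auto simp: g_def)
    then show ?thesis
      using True gout gside gside' side'[of j] side'[of k] that pq(3)
      by (auto simp: I_def J_def hull2_def e_def min_def max_def)
  next
    case False
    then show ?thesis
      using gout gside gside' side'[of j] side'[of k] that pq(3)
      by (auto simp: I_def J_def hull2_def e_def min_def max_def)
  qed
  have memI: "fst (I j) \<in> S \<and> snd (I j) \<in> S \<and> fst (I j) < snd (I j)" if "j < k" for j
    using fS[of j] eS[of j] side'[of j] that pq(3) by (auto simp: I_def hull2_def e_def min_def max_def)
  have memJ: "fst J \<in> S \<and> snd J \<in> S \<and> fst J < snd J"
    using fS[of k] gS gout side'[of k] by (auto simp: J_def hull2_def min_def max_def)
  \<comment> \<open>For \<open>k + i \<le> l\<close> the subtraction truncates to \<open>0\<close>: long loops wait at the central interval \<open>I 0\<close>.\<close>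
  define A where "A i = (if i = 0 \<or> i = l then J else I (k + i - l))" for i
  have "covers \<sigma> (A i) (A (Suc i))" if "i < l" for i
  proof -
    have "i = 0 \<or> 0 < i \<and> Suc i = l \<or> 0 < i \<and> Suc i < l \<and> k + i < l \<or> 0 < i \<and> Suc i < l \<and> l \<le> k + i"
      using that by linarith
    then consider "i = 0" | "0 < i" "Suc i = l" | "0 < i" "Suc i < l" "k + i < l" | "0 < i" "Suc i < l" "l \<le> k + i"
      by blast
    then show ?thesis
    proof cases
      case 1
      have "k + 1 - l < k" using l k by auto
      \<comment> \<open>The index entered from \<open>J\<close>: it is \<open>0\<close> if
        \<open>k < l\<close>; otherwise \<open>l\<close> is even and the index lies
        \<open>l - 2\<close> below \<open>k - 1\<close>, an even distance as \<open>covJ\<close>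
        demands.\<close>
      moreover have "k + 1 - l = 0 \<or> even (k - 1 - (k + 1 - l))"
        using kl l by auto
      ultimately show ?thesis using 1 l covJ[of "k + 1 - l"] by (auto simp: A_def)
    next
      case 2
      then have "k + i - l = k - 1" by auto
      with 2 show ?thesis using covIJ by (auto simp: A_def)
    next
      case 3
      then have "k + i - l = 0" "k + Suc i - l = 0" by auto
      with 3 show ?thesis using cov0 by (simp add: A_def)
    next
      case 4
      then have "k + Suc i - l = Suc (k + i - l)" by auto
      with 4 show ?thesis using covI[of "k + i - l"] by (simp add: A_def)
    qed
  qed
  moreover have "fst (A i) \<in> S \<and> snd (A i) \<in> S \<and> fst (A i) < snd (A i)" if "i < l" for i
    using memI[of "k + i - l"] memJ that k by (auto simp: A_def)
  moreover have "snd (A i) \<le> fst (A 0) \<or> snd (A 0) \<le> fst (A i)" if "0 < i" "i < l" for i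
    using disj[of "k + i - l"] that k by (auto simp: A_def)
  ultimately show ?thesis
    using l by (intro exI[of _ A]) (auto simp: elementary_loop_def A_def[of 0] A_def[of l])
qed

text \<open>If a nonempty \<open>A\<close> in the left half is invariant under the square, then
  \<open>A\<close> together with its image under \<open>\<sigma>\<close> is invariant in
  \<open>S\<close>, so \<open>A\<close> is the whole half. Since \<open>\<sigma>\<close> injects
  each half into the other, they have equal size.\<close>

lemma all_switch_half:
  fixes S :: "'a::linorder set"
  assumes cyc: "cycle_on S \<sigma>"
    and pq: "p < q" "p \<in> S" "\<And>x. x \<in> S \<Longrightarrow> x \<le> p \<or> q \<le> x"
    and switch: "\<And>x. x \<in> S \<Longrightarrow> x \<le> p \<longleftrightarrow> \<not> \<sigma> x \<le> p"
  defines "L \<equiv> {x \<in> S. x \<le> p}"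
  shows "cycle_on L (\<sigma> \<circ> \<sigma>)" and "card S = 2 * card L"
proof -
  note fin = cycle_onD(1)[OF cyc] and clo = cycle_onD(2)[OF cyc]
  note inj = cycle_on_inj[OF cyc]
  define R where "R = {x \<in> S. \<not> x \<le> p}"
  have S: "S = L \<union> R" "L \<inter> R = {}" by (auto simp: L_def R_def)
  show "cycle_on L (\<sigma> \<circ> \<sigma>)"
    unfolding cycle_on_def
  proof (intro conjI allI impI)
    show "finite L" "(\<sigma> \<circ> \<sigma>) ` L \<subseteq> L" using fin clo switch by (auto simp: L_def)
    fix A assume A: "A \<subseteq> L" "A \<noteq> {}" "(\<sigma> \<circ> \<sigma>) ` A \<subseteq> A"
    then have "A \<union> \<sigma> ` A = S"
      using clo by (intro cycle_onD(3)[OF cyc]) (auto simp: L_def)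
    moreover have "\<sigma> ` A \<subseteq> R" using A clo switch by (auto simp: L_def R_def)
    ultimately show "A = L" using S A(1) by auto
  qed
  have "\<sigma> ` L \<subseteq> R" "\<sigma> ` R \<subseteq> L" using clo switch by (auto simp: L_def R_def)
  then have "card L \<le> card R" "card R \<le> card L"
    using fin inj by (auto intro!: card_inj_on_le[of \<sigma>] simp: L_def R_def elim: inj_on_subset)
  moreover have "card S = card L + card R"
    using S fin by (metis card_Un_disjoint finite_Un)
  ultimately show "card S = 2 * card L" by simp
qed

text \<open>Each interval is followed by the hull of the images of its end points. These hulls lie
  to the right of \<open>p\<close>, hence away from the first interval.\<close>

lemma elementary_loop_lift:
  fixes S :: "'a::linorder set"
  assumes cyc: "cycle_on S \<sigma>"
    and switch: "\<And>x. x \<in> S \<Longrightarrow> x \<le> p \<longleftrightarrow> \<not> \<sigma> x \<le> p"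
    and loop: "elementary_loop {x \<in> S. x \<le> p} (\<sigma> \<circ> \<sigma>) l A"
  shows "\<exists>B. elementary_loop S \<sigma> (2 * l) B"
proof -
  note clo = cycle_onD(2)[OF cyc] and inj = cycle_on_inj[OF cyc]
  have l: "0 < l" "A l = A 0"
    and A: "\<And>i. i < l \<Longrightarrow> fst (A i) \<in> S \<and> snd (A i) \<in> S \<and> fst (A i) \<le> p \<and> snd (A i) \<le> p \<and> fst (A i) < snd (A i)"
    and cov: "\<And>i. i < l \<Longrightarrow> covers (\<sigma> \<circ> \<sigma>) (A i) (A (Suc i))"
    and disj: "\<And>i. 0 < i \<Longrightarrow> i < l \<Longrightarrow> snd (A i) \<le> fst (A 0) \<or> snd (A 0) \<le> fst (A i)"
    using loop by (auto simp: elementary_loop_def)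
  define K where "K i = hull2 (\<sigma> (fst (A i))) (\<sigma> (snd (A i)))" for i
  define B where "B i = (if even i then A (i div 2) else K (i div 2))" for i
  have K: "fst (K i) \<in> S \<and> snd (K i) \<in> S \<and> fst (K i) < snd (K i) \<and> p < fst (K i)" if "i < l" for i
  proof -
    have "\<sigma> (fst (A i)) \<noteq> \<sigma> (snd (A i))"
      using A[OF that] inj by (metis inj_on_contraD order_less_irrefl)
    moreover have "\<sigma> (fst (A i)) \<in> S" "\<sigma> (snd (A i)) \<in> S" "p < \<sigma> (fst (A i))" "p < \<sigma> (snd (A i))"
      using A[OF that] clo switch by (auto simp: not_le[symmetric])
    ultimately show ?thesis
      by (auto simp: K_def hull2_def min_def max_def)
  qed
  have "covers \<sigma> (B i) (B (Suc i))" if "i < 2 * l" for i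
  proof (cases "even i")
    case True
    then show ?thesis by (auto simp: B_def covers_def K_def hull2_def)
  next
    case False
    then have i: "i div 2 < l" "Suc i div 2 = Suc (i div 2)" using that by presburger+
    show ?thesis
      using cov[OF i(1)] False i(2)
      by (auto simp: B_def covers_def K_def hull2_def min_def max_def split: if_splits)
  qed
  moreover have "fst (B i) \<in> S \<and> snd (B i) \<in> S \<and> fst (B i) < snd (B i)" if "i < 2 * l" for i
    using A[of "i div 2"] K[of "i div 2"] that by (auto simp: B_def)
  moreover have "snd (B i) \<le> fst (B 0) \<or> snd (B 0) \<le> fst (B i)" if "0 < i" "i < 2 * l" for i
  proof (cases "even i")
    case True
    then show ?thesis using disj[of "i div 2"] that by (auto simp: B_def elim!: evenE)
  next
    case False
    then show ?thesis using A[of 0] K[of "i div 2"] that l by (fastforce simp: B_def)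
  qed
  ultimately show ?thesis
    using l by (intro exI[of _ B]) (auto simp: elementary_loop_def B_def[of 0] B_def[of "2 * l"])
qed

section \<open>Arithmetic of the Sharkovskii order and induction on the length of the cycle\<close>

lemma sharkovskii_ge_2: "n \<lhd>\<^sub>S m \<Longrightarrow> 2 \<le> n"
proof (induction rule: sharkovskii.induct)
  case (tail l k)
  then show ?case using self_le_power[of 2 k] by simp
next
  case (same_row r s k)
  then show ?case using mult_le_mono[of 1 "2 ^ k" 2 r] by simp
next
  case (later_row r s k l)
  then show ?case using mult_le_mono[of 1 "2 ^ k" 2 r] by simp
next
  case (row_tail r k l)
  then show ?case using mult_le_mono[of 1 "2 ^ k" 2 r] by simp
qed

lemma sharkovskii_pos: "n \<lhd>\<^sub>S m \<Longrightarrow> 0 < m"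
  by (induction rule: sharkovskii.induct) auto

lemma sharkovskii_odd_less: "n \<lhd>\<^sub>S m \<Longrightarrow> odd m \<Longrightarrow> m \<noteq> 1 \<Longrightarrow> n < m"
  by (induction rule: sharkovskii.induct) (auto split: if_splits)

text \<open>An even number is followed only by even numbers and \<open>1\<close>. Lowering both
  exponents of \<open>2\<close> by one respects each of the four rules.\<close>

lemma sharkovskii_double:
  assumes "2 * n \<lhd>\<^sub>S m" "m \<noteq> 1"
  obtains m' where "m = 2 * m'" "n \<lhd>\<^sub>S m'"
proof -
  have *: "\<exists>k'. k = Suc k'" if "2 * n = 2 ^ k * (r::nat)" "odd r" for k r
    using that by (cases k) (auto dest: sym)
  from assms show ?thesis
  proof cases
    case (same_row r s k)
    then obtain k' where "k = Suc k'" using * by blast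
    with same_row show ?thesis
      by (intro that[of "2 ^ k' * s"]) (auto intro: sharkovskii.intros)
  next
    case (later_row r s k l)
    then obtain k' where "k = Suc k'" using * by blast
    with later_row show ?thesis
      by (intro that[of "2 ^ (l - 1) * s"]) (cases l; auto intro: sharkovskii.intros)+
  next
    case (row_tail r k l)
    then obtain k' where "k = Suc k'" using * by blast
    with row_tail assms(2) show ?thesis
      by (intro that[of "2 ^ (l - 1)"]) (cases l; auto intro: sharkovskii.intros)+
  next
    case (tail l k)
    then obtain k' where "k = Suc k'" using *[of k 1] by auto
    with tail assms(2) show ?thesis
      by (intro that[of "2 ^ (l - 1)"]) (cases l; auto intro: sharkovskii.intros)+
  qed
qed

lemma sharkovskii_elementary_loop:
  fixes S :: "'a::linorder set"
  assumes "cycle_on S \<sigma>" and "card S \<lhd>\<^sub>S m"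
  shows "\<exists>A. elementary_loop S \<sigma> m A"
  using assms
proof (induction "card S" arbitrary: S \<sigma> m rule: less_induct)
  case less
  note cyc = \<open>cycle_on S \<sigma>\<close> and shark = \<open>card S \<lhd>\<^sub>S m\<close>
  have card: "2 \<le> card S" using shark by (rule sharkovskii_ge_2)
  obtain p q where pq: "p \<in> S" "q \<in> S" "p < q" "\<And>x. x \<in> S \<Longrightarrow> x \<le> p \<or> q \<le> x"
    "q \<le> \<sigma> p" "\<sigma> q \<le> p"
    using cycle_on_center[OF cyc card] by blast
  consider "m = 1" | "m \<noteq> 1" "\<exists>x\<in>S. x \<le> p \<longleftrightarrow> \<sigma> x \<le> p"
    | "m \<noteq> 1" "\<And>x. x \<in> S \<Longrightarrow> x \<le> p \<longleftrightarrow> \<not> \<sigma> x \<le> p" by blast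
  then show ?case
  proof cases
    case 1
    with pq have "elementary_loop S \<sigma> m (\<lambda>_. (p, q))"
      by (auto simp: elementary_loop_def covers_def min_def max_def)
    then show ?thesis by blast
  next
    case 2
    then show ?thesis
      \<comment> \<open>An odd \<open>m\<close> other than \<open>1\<close> exceeds
        \<open>card S\<close>; every other \<open>m\<close> here is even. These are the two lengths
        available.\<close>
      using sharkovskii_pos[OF shark] sharkovskii_odd_less[OF shark]
      by (intro elementary_loop_if_not_all_switch[OF cyc pq]) auto
  next
    case 3
    note half = all_switch_half[OF cyc pq(3,1,4) 3(2)]
    obtain m' where m': "m = 2 * m'" "card {x \<in> S. x \<le> p} \<lhd>\<^sub>S m'"
      using sharkovskii_double shark 3(1) half(2) by metis
    have "card {x \<in> S. x \<le> p} < card S" using half(2) card by auto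
    then obtain A where "elementary_loop {x \<in> S. x \<le> p} (\<sigma> \<circ> \<sigma>) m' A"
      using less.hyps[OF _ half(1) m'(2)] by blast
    with elementary_loop_lift[OF cyc 3(2)] m'(1) show ?thesis by blast
  qed
qed

section \<open>From loops of the orbit's permutation to periodic points of the map\<close>

theorem theorem11:
  fixes a b R :: real
    and \<Xi> :: "'b::banach set"
    and G :: "(real \<times> (real ^ 'k) \<times> 'b) set"
    and F :: "real \<times> (real ^ 'k) \<times> 'b \<Rightarrow> real \<times> (real ^ 'k) \<times> 'b"
    and o\<^sub>0 :: "real \<times> (real ^ 'k) \<times> 'b"
    and p \<delta> :: "nat \<Rightarrow> real"
    and n m :: nat
  assumes "R > 0"
    and "closed \<Xi>" and "convex \<Xi>" and "bounded \<Xi>"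
    and "G = {a..b} \<times> max_cball R \<times> \<Xi>"
    and "F ` G \<subseteq> interior {a..b} \<times> max_ball R \<times> \<Xi>"
    and "continuous_on G F"
    and "compact_map_on G F"
    and "periodic_point_on G F n o\<^sub>0"
    and "\<And>i. p i = fst ((F ^^ i) o\<^sub>0)"
    and "\<And>i. i < n \<Longrightarrow> \<delta> i > 0"
    and "\<And>i. i < n \<Longrightarrow> {p i - \<delta> i..p i + \<delta> i} \<subseteq> {a..b}"
    and "disjoint_family_on (\<lambda>i. {p i - \<delta> i..p i + \<delta> i}) {..<n}"
    and "\<And>i j. i < n \<Longrightarrow> j = Suc i mod n \<Longrightarrow>
           F ` ({p i - \<delta> i..p i + \<delta> i} \<times> max_cball R \<times> \<Xi>)
             \<subseteq> {p j - \<delta> j<..<p j + \<delta> j} \<times> max_ball R \<times> \<Xi>"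
    and "n \<lhd>\<^sub>S m"
  shows "\<exists>x. periodic_point_on G F m x"
proof -
  note \<Xi> = assms(2-4) and G = assms(5) and maps = assms(6) and contF = assms(7) and compF = assms(8)
    and per = assms(9) and p = assms(10) and \<delta> = assms(11) and \<delta>I = assms(12) and disj = assms(13)
    and traps = assms(14) and shark = assms(15)
  let ?C = "(max_cball R :: (real ^ 'k) set) \<times> \<Xi>"
  have n: "0 < n" and m: "0 < m"
    using sharkovskii_ge_2[OF shark] sharkovskii_pos[OF shark] by auto
  have "(F ^^ n) o\<^sub>0 = o\<^sub>0" and o\<^sub>0: "o\<^sub>0 \<in> G"
    using per n unfolding periodic_point_on_def by force+
  then have p_mod: "p (k mod n) = p k" for k
    by (simp add: p funpow_mod_eq)
  have sep: "{p i - \<delta> i..p i + \<delta> i} \<inter> {p j - \<delta> j..p j + \<delta> j} = {}" if "i < n" "j < n" "i \<noteq> j" for i j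
    using disjoint_family_onD[OF disj] that by auto
  have inj: "inj_on p {..<n}"
  proof (rule inj_onI, rule ccontr)
    fix i j assume ij: "i \<in> {..<n}" "j \<in> {..<n}" "p i = p j" "i \<noteq> j"
    then show False using sep[of i j] \<delta>[of i] \<delta>[of j] by auto
  qed
  \<comment> \<open>The orbit is identified with its first coordinates. The index in
    \<open>\<sigma>\<close> needs no reduction modulo \<open>n\<close>, as \<open>p\<close> is
    itself \<open>n\<close>-periodic.\<close>
  define S where "S = p ` {..<n}"
  define idx where "idx = inv_into {..<n} p"
  define \<sigma> where "\<sigma> x = p (Suc (idx x))" for x
  define d where "d x = \<delta> (idx x)" for x
  have idx: "idx (p i) = i" if "i < n" for i
    using inj that by (simp add: idx_def)
  have \<sigma>p: "\<sigma> (p k) = p (Suc k)" for k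
  proof -
    have "\<sigma> (p k) = p (Suc (k mod n))"
      using idx[of "k mod n"] n p_mod[of k] by (simp add: \<sigma>_def)
    also have "\<dots> = p (Suc k)"
      using p_mod[of "Suc (k mod n)"] p_mod[of "Suc k"] by (simp add: mod_Suc_eq)
    finally show ?thesis .
  qed
  have pS: "p k \<in> S" for k
    using n p_mod[of k] by (metis S_def imageI lessThan_iff mod_less_divisor)
  have cyc: "cycle_on S \<sigma>"
    unfolding cycle_on_def
  proof (intro conjI allI impI)
    show "finite S" by (simp add: S_def)
    show "\<sigma> ` S \<subseteq> S" using pS by (auto simp: \<sigma>_def)
    fix A assume A: "A \<subseteq> S" "A \<noteq> {}" "\<sigma> ` A \<subseteq> A"
    then obtain i where i: "i < n" "p i \<in> A" by (auto simp: S_def)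
    have orbit: "p (i + k) \<in> A" for k
    proof (induction k)
      case (Suc k)
      then have "\<sigma> (p (i + k)) \<in> A" using A(3) by blast
      then show ?case by (simp add: \<sigma>p)
    qed (use i in simp)
    have "p j \<in> A" for j
      using orbit[of "j + (n - i)"] i(1) p_mod[of "j + n"] p_mod[of j] by simp
    then show "A = S" using A(1) by (auto simp: S_def)
  qed
  have "card S = n" using inj by (simp add: S_def card_image)
  then obtain A where "elementary_loop S \<sigma> m A"
    using sharkovskii_elementary_loop[OF cyc] shark by metis
  then have A_m: "A m = A 0"
    and A: "\<And>i. i < m \<Longrightarrow> fst (A i) \<in> S \<and> snd (A i) \<in> S \<and> fst (A i) < snd (A i)"
    and cov: "\<And>i. i < m \<Longrightarrow> covers \<sigma> (A i) (A (Suc i mod m))"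
    and A_disj: "\<And>i. 0 < i \<Longrightarrow> i < m \<Longrightarrow> snd (A i) \<le> fst (A 0) \<or> snd (A 0) \<le> fst (A i)"
    unfolding elementary_loop_def by (auto simp: mod_Suc)
  have d: "0 < d x" "{x - d x..x + d x} \<subseteq> {a..b}" if "x \<in> S" for x
    using that \<delta> \<delta>I by (auto simp: S_def d_def idx)
  have less: "x + d x < y - d y" if xy: "x \<in> S" "y \<in> S" "x < y" for x y
  proof -
    obtain i j where ij: "i < n" "j < n" "x = p i" "y = p j" using xy by (auto simp: S_def)
    then have "{x - d x..x + d x} \<inter> {y - d y..y + d y} = {}"
      using sep[of i j] xy(3) by (auto simp: d_def idx)
    \<comment> \<open>A common point of overlapping neighbourhoods; so disjointness forces them into
      the order of their centres.\<close>
    moreover have "max x (y - d y) \<in> {x - d x..x + d x} \<inter> {y - d y..y + d y}" if "y - d y \<le> x + d x"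
      using that d(1)[OF xy(1)] d(1)[OF xy(2)] xy(3) by auto
    ultimately show ?thesis by force
  qed
  have mono: "x + d x \<le> y + d y \<and> x - d x \<le> y - d y" if "x \<in> S" "y \<in> S" "x \<le> y" for x y
    using less[of x y] d(1)[of x] d(1)[of y] that by (cases "x = y") auto
  have trap: "\<sigma> x - d (\<sigma> x) < fst (F (t, z))" "fst (F (t, z)) < \<sigma> x + d (\<sigma> x)"
    if x: "x \<in> S" "t \<in> {x - d x..x + d x}" "z \<in> ?C" for x t z
  proof -
    obtain i where i: "i < n" "x = p i" using x(1) by (auto simp: S_def)
    have "\<sigma> x = p (Suc i mod n)" by (simp add: i \<sigma>p p_mod)
    moreover have "d (\<sigma> x) = \<delta> (Suc i mod n)" using n idx by (simp add: calculation d_def)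
    moreover have "(t, z) \<in> {p i - \<delta> i..p i + \<delta> i} \<times> ?C"
      using x(2,3) i by (simp add: d_def idx)
    ultimately show "\<sigma> x - d (\<sigma> x) < fst (F (t, z))" "fst (F (t, z)) < \<sigma> x + d (\<sigma> x)"
      using traps[OF i(1) refl] by (force simp: image_subset_iff mem_Times_iff)+
  qed
  \<comment> \<open>\<open>A i\<close> with the inner halves of the neighbourhoods of its end points
    cut off. The new ends still belong to those neighbourhoods, so \<open>trap\<close> controls
    their images.\<close>
  define \<alpha> where "\<alpha> i = fst (A i) + d (fst (A i))" for i
  define \<beta> where "\<beta> i = snd (A i) - d (snd (A i))" for i
  have "bounded (max_cball R :: (real ^ 'k) set)"
    unfolding bounded_iff max_cball_def
    using norm_le_infnorm by (metis (mono_tags, lifting) mem_Collect_eq mult_left_mono order_trans real_sqrt_ge_zero of_nat_0_le_iff)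
  then have "bounded G"
    using \<Xi> by (auto simp: G intro!: bounded_Times)
  then have compact: "compact (closure (F ` G))"
    using compF by (auto simp: compact_map_on_def)
  have "closed (max_cball R :: (real ^ 'k) set)"
    unfolding max_cball_def by (intro closed_Collect_le continuous_intros)
  then have "closed G"
    using \<Xi> by (auto simp: G intro!: closed_Times)
  moreover have FG: "F ` G \<subseteq> G"
    using maps interior_subset[of "{a..b}"] by (force simp: G max_ball_def max_cball_def)
  ultimately have closure: "closure (F ` G) \<subseteq> G"
    by (intro closure_minimal)
  have "convex (max_cball R :: (real ^ 'k) set)"
  proof (rule convexI)
    fix x y :: "real ^ 'k" and u v :: real
    assume *: "x \<in> max_cball R" "y \<in> max_cball R" "0 \<le> u" "0 \<le> v" "u + v = 1"
    have "infnorm (u *\<^sub>R x + v *\<^sub>R y) \<le> u * infnorm x + v * infnorm y"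
      using infnorm_triangle[of "u *\<^sub>R x" "v *\<^sub>R y"] * by (simp add: infnorm_mul)
    also have "\<dots> \<le> R"
      using * by (intro convex_bound_le) (auto simp: max_cball_def)
    finally show "u *\<^sub>R x + v *\<^sub>R y \<in> max_cball R" by (simp add: max_cball_def)
  qed
  then have convex: "convex ?C"
    using \<Xi> by (intro convex_Times)
  have \<alpha>\<beta>: "\<alpha> i < \<beta> i" "{\<alpha> i..\<beta> i} \<subseteq> {a..b}" if "i < m" for i
  proof -
    show "\<alpha> i < \<beta> i" using less A[OF that] by (simp add: \<alpha>_def \<beta>_def)
    show "{\<alpha> i..\<beta> i} \<subseteq> {a..b}"
      using d[of "fst (A i)"] d[of "snd (A i)"] A[OF that] by (auto simp: \<alpha>_def \<beta>_def)
  qed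
  have "\<exists>x. (\<forall>i<m. (F ^^ i) x \<in> {\<alpha> i..\<beta> i} \<times> ?C) \<and> (F ^^ m) x = x"
  proof (rule covering_loop_fixed_point[OF m convex])
    show "?C \<noteq> {}" using o\<^sub>0 by (auto simp: G)
    show "continuous_on ({a..b} \<times> ?C) F" using contF by (simp add: G)
    \<comment> \<open>Compactness of \<open>F\<close> on the bounded set \<open>G\<close> supplies
      the compact set for Schauder's theorem; closedness of \<open>G\<close> keeps it inside
      \<open>?C\<close>.\<close>
    show "compact (snd ` closure (F ` G))"
      using compact by (intro compact_continuous_image continuous_intros)
    show "snd ` closure (F ` G) \<subseteq> ?C" using closure by (auto simp: G)
    show "snd (F x) \<in> snd ` closure (F ` G)" if "x \<in> {a..b} \<times> ?C" for x
      using that closure_subset[of "F ` G"] unfolding G by blast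
    fix i assume i: "i < m"
    show "\<alpha> i \<le> \<beta> i" "{\<alpha> i..\<beta> i} \<subseteq> {a..b}" using \<alpha>\<beta>[OF i] by auto
    define u v s t where uvst: "u = fst (A i)" "v = snd (A i)" "s = fst (A (Suc i mod m))" "t = snd (A (Suc i mod m))"
    have mem: "u \<in> S" "v \<in> S" "s \<in> S" "t \<in> S"
      using A[OF i] A[of "Suc i mod m"] m by (auto simp: uvst)
    then have \<sigma>mem: "\<sigma> u \<in> S" "\<sigma> v \<in> S" using cycle_onD(2)[OF cyc] by auto
    have F: "\<sigma> u - d (\<sigma> u) < fst (F (\<alpha> i, z)) \<and> fst (F (\<alpha> i, z)) < \<sigma> u + d (\<sigma> u) \<and>
        \<sigma> v - d (\<sigma> v) < fst (F (\<beta> i, z)) \<and> fst (F (\<beta> i, z)) < \<sigma> v + d (\<sigma> v)" if "z \<in> ?C" for z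
      using trap[OF mem(1) _ that, of "\<alpha> i"] trap[OF mem(2) _ that, of "\<beta> i"] d(1)[OF mem(1)] d(1)[OF mem(2)]
      by (simp add: \<alpha>_def \<beta>_def uvst)
    have "\<sigma> u \<le> s \<and> t \<le> \<sigma> v \<or> \<sigma> v \<le> s \<and> t \<le> \<sigma> u"
      using cov[OF i] A[of "Suc i mod m"] m by (auto simp: covers_def uvst min_def max_def split: if_splits)
    then show "(\<forall>z\<in>?C. fst (F (\<alpha> i, z)) < \<alpha> (Suc i mod m) \<and> \<beta> (Suc i mod m) < fst (F (\<beta> i, z))) \<or>
      (\<forall>z\<in>?C. fst (F (\<beta> i, z)) < \<alpha> (Suc i mod m) \<and> \<beta> (Suc i mod m) < fst (F (\<alpha> i, z)))"
    proof
      assume "\<sigma> u \<le> s \<and> t \<le> \<sigma> v"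
      then have "\<sigma> u + d (\<sigma> u) \<le> \<alpha> (Suc i mod m)" "\<beta> (Suc i mod m) \<le> \<sigma> v - d (\<sigma> v)"
        using mono \<sigma>mem mem by (auto simp: \<alpha>_def \<beta>_def uvst)
      then show ?thesis using F by (intro disjI1) (meson less_le_trans le_less_trans)
    next
      assume "\<sigma> v \<le> s \<and> t \<le> \<sigma> u"
      then have "\<sigma> v + d (\<sigma> v) \<le> \<alpha> (Suc i mod m)" "\<beta> (Suc i mod m) \<le> \<sigma> u - d (\<sigma> u)"
        using mono \<sigma>mem mem by (auto simp: \<alpha>_def \<beta>_def uvst)
      then show ?thesis using F by (intro disjI2) (meson less_le_trans le_less_trans)
    qed
  qed
  then obtain x where x: "\<And>i. i < m \<Longrightarrow> (F ^^ i) x \<in> {\<alpha> i..\<beta> i} \<times> ?C" and x_per: "(F ^^ m) x = x"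
    by blast
  have "periodic_point_on G F m x"
    unfolding periodic_point_on_def
  proof (intro conjI allI impI)
    fix k assume "k < m"
    then show "(F ^^ k) x \<in> G" using x[of k] \<alpha>\<beta>(2)[of k] by (auto simp: G)
  next
    fix k assume k: "0 < k \<and> k < m"
    show "(F ^^ k) x \<noteq> x"
    proof
      assume "(F ^^ k) x = x"
      then have "fst x \<in> {\<alpha> 0..\<beta> 0}" "fst x \<in> {\<alpha> k..\<beta> k}"
        using x[OF m] x[of k] k by (auto simp: mem_Times_iff)
      \<comment> \<open>\<open>A 0\<close> and \<open>A k\<close> may share an end point, but the
        cut-off pieces have positive length and separate the two real intervals.\<close>
      then show False
        using A_disj[of k] k A[OF m] A[of k] d(1)[of "fst (A 0)"] d(1)[of "snd (A 0)"]
          d(1)[of "fst (A k)"] d(1)[of "snd (A k)"] by (auto simp: \<alpha>_def \<beta>_def)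
    qed
  qed (use m x_per in auto)
  then show ?thesis ..
qed

end
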